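(* Let $n\ge 1$ and let $E$ be a closed subset of $\mathbb{R}^n$. Then for every integer $k$ with $1\le k\le n+1$, the $k$-medial axis $M_k=M_k(E)$ of $E$ is $(n-k+1)$-rectifiable. In particular, $M_k$ has Hausdorff dimension at most $n-k+1$.
   Context: For $x,y\in\mathbb{R}^n$, $d(x,y)$ is the Euclidean distance. For a closed set $E\subset\mathbb{R}^n$ and $x\in\mathbb{R}^n$, set $d(x)=d(x,E)=\inf\{d(x,y):y\in E\}$ and let $\phi(x)=\{y\in E: d(x,y)=d(x)\}$ be the set of points of $E$ closest to $x$. For a positive integer $k$ with $1\le k\le n+1$, the $k$-medial axis $M_k=M_k(E)$ is the set of $x\in\mathbb{R}^n$ such that $\phi(x)$ contains $k$ points not all lying in a $(k-2)$-dimensional affine plane, i.e. $k$ affinely independent points (for $k=1$ this just means $\phi(x)\ne\emptyset$). A set $S\subset\mathbb{R}^n$ is $m$-rectifiable if there are countably many Lipschitz maps $f_i:\mathbb{R}^m\to\mathbb{R}^n$ such that $\mathcal{H}^m\left(S\setminus\bigcup_i f_i(\mathbb{R}^m)\right)=0$, where $\mathcal{H}^m$ is $m$-dimensional Hausdorff measure (for $m=0$: $S$ is countable). *)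

theory Defs
  imports "HOL-Analysis.Analysis"
begin

definition closest_points :: "'a::metric_space set \<Rightarrow> 'a \<Rightarrow> 'a set"
  where "closest_points E x = {y \<in> E. dist x y = infdist x E}"

definition medial_axis :: "nat \<Rightarrow> 'a::euclidean_space set \<Rightarrow> 'a set"
  where "medial_axis k E =
    {x. \<exists>A. A \<subseteq> closest_points E x \<and> finite A \<and> card A = k \<and> \<not> affine_dependent A}"

(* The summand diam(U)^s of the Hausdorff measure, with the usual conventions that the
   empty set contributes 0 and that diam(U)^0 = 1 for nonempty U (in HOL, 0 powr 0 = 0). *)
definition diam_pow :: "real \<Rightarrow> 'a::metric_space set \<Rightarrow> ennreal"
  where "diam_pow s U =
    (if U = {} then 0 else if s = 0 then 1 else ennreal (diameter U powr s))"

(* diameter is meaningful only for bounded sets, hence the explicit boundedness condition.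
   Finite covers are included, since the covering sets may be empty. *)
definition hausdorff_premeasure :: "real \<Rightarrow> real \<Rightarrow> 'a::metric_space set \<Rightarrow> ennreal"
  where "hausdorff_premeasure s \<delta> S =
    (INF U \<in> {U :: nat \<Rightarrow> 'a set.
        S \<subseteq> (\<Union>i. U i) \<and> (\<forall>i. bounded (U i) \<and> diameter (U i) \<le> \<delta>)}.
      \<Sum>i. diam_pow s (U i))"

(* The s-dimensional Hausdorff (outer) measure for s \<ge> 0, without a normalising constant;
   the constant affects neither null sets nor the dimension. *)
definition hausdorff_measure :: "real \<Rightarrow> 'a::metric_space set \<Rightarrow> ennreal"
  where "hausdorff_measure s S = (SUP \<delta> \<in> {0<..}. hausdorff_premeasure s \<delta> S)"

definition hausdorff_dimension :: "'a::metric_space set \<Rightarrow> ennreal"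
  where "hausdorff_dimension S =
    (INF s \<in> {s :: real. 0 \<le> s \<and> hausdorff_measure s S = 0}. ennreal s)"

(* For a dimension m that is a term rather than a type, R^m is
   topspace (Euclidean_space m), the set of sequences x with x i = 0 for all i \<ge> m;
   its Euclidean distance is the L2 norm of the difference over the first m coordinates. *)
definition lipschitz_from_Rm ::
    "nat \<Rightarrow> ((nat \<Rightarrow> real) \<Rightarrow> 'a::metric_space) \<Rightarrow> bool"
  where "lipschitz_from_Rm m f \<longleftrightarrow>
    (\<exists>L\<ge>0. \<forall>x \<in> topspace (Euclidean_space m). \<forall>y \<in> topspace (Euclidean_space m).
      dist (f x) (f y) \<le> L * L2_set (\<lambda>i. x i - y i) {..<m})"

definition rectifiable :: "nat \<Rightarrow> 'a::metric_space set \<Rightarrow> bool"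
  where "rectifiable m S \<longleftrightarrow>
    (if m = 0 then countable S
     else \<exists>f :: nat \<Rightarrow> (nat \<Rightarrow> real) \<Rightarrow> 'a.
       (\<forall>i. lipschitz_from_Rm m (f i)) \<and>
       hausdorff_measure (real m) (S - (\<Union>i. f i ` topspace (Euclidean_space m))) = 0)"

end

theory Submission
  imports Defs
begin

text \<open>
  The idea is to cut the medial axis into countably many pieces, each of which is contained in a
  Lipschitz graph over a coordinate subspace of dimension \<open>n + 1 - k\<close>.

  If \<open>y\<close> is a point of \<open>E\<close> closest to \<open>x\<close>, and \<open>y'\<close> one closest to \<open>x'\<close>, then
  \<open>(x - x') \<bullet> (y - y') \<ge> 0\<close> (\<open>closest_points_monotone\<close>). For a finite set \<open>Q\<close> from a countable
  dense set and a radius \<open>r = 1 / (N + 1)\<close>, let \<open>P\<close> consist of the points \<open>x\<close> that have a closest point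
  within \<open>r\<close> of each \<open>q \<in> Q\<close>. Let \<open>A\<close> be a set of \<open>k\<close> affinely independent points closest to some
  point of \<open>P\<close>, approximated within \<open>r\<close> by \<open>Q\<close>. Applying the monotonicity to points near \<open>a\<close> and
  \<open>b\<close>, and again with \<open>a\<close> and \<open>b\<close> interchanged, shows that a difference \<open>w\<close> of two points of \<open>P\<close> is
  almost orthogonal to all differences of points of \<open>A\<close>: \<open>\<bar>w \<bullet> (a - b)\<bar> \<le> 4 * r * norm w\<close>. The \<open>k - 1\<close>
  independent vectors \<open>a - b\<close> (with \<open>b\<close> fixed) are completed to a basis by a set \<open>J\<close> of \<open>n + 1 - k\<close>
  coordinate vectors, and so for small \<open>r\<close> the coordinates of \<open>w\<close> in \<open>J\<close> alone control \<open>norm w\<close>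
  (\<open>affine_independent_complement\<close>). Hence \<open>P\<close> is a graph over the \<open>J\<close>-coordinates. There are only
  countably many pairs \<open>(Q, N)\<close>, which gives \<open>medial_axis_countable_cover\<close>.

  Rectifiability follows by extending the inverse of the coordinate projection, one component at
  a time, to a Lipschitz map on the whole of \<open>\<real>\<^sup>m\<close>, where \<open>m = n + 1 - k\<close> (\<open>mcshane_extension\<close>).
  The bound on the dimension is obtained by covering a bounded part of a graph by the parts of it
  that lie over a grid of small cubes (\<open>coord_graph_bounded_null\<close>).
\<close>

section \<open>Graphs over coordinate subspaces\<close>

text \<open>
  The set \<open>S\<close> is a Lipschitz graph over a subset of the span of \<open>J\<close>, a set of coordinate vectors:
  the coordinates in \<open>J\<close> separate the points of \<open>S\<close>, and the inverse of the projection to these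
  coordinates is Lipschitz on the image of \<open>S\<close>. The constant \<open>C\<close> refers to the \<open>\<ell>\<^sup>1\<close> norm on the
  coordinates. For \<open>J = {}\<close> the condition says that \<open>S\<close> has at most one point.
\<close>

definition coord_graph :: "'a::euclidean_space set \<Rightarrow> real \<Rightarrow> 'a set \<Rightarrow> bool"
  where "coord_graph J C S \<longleftrightarrow>
    (\<forall>x\<in>S. \<forall>y\<in>S. norm (x - y) \<le> C * (\<Sum>b\<in>J. \<bar>(x - y) \<bullet> b\<bar>))"

section \<open>Covering the medial axis by graphs\<close>

text \<open>
  The metric projection onto \<open>E\<close>, as a multivalued map, is monotone: this is the monotonicity of
  the subdifferential of the convex function \<open>\<lambda>x. (norm x)\<^sup>2 - (infdist x E)\<^sup>2\<close>.
\<close>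

lemma closest_points_monotone:
  fixes E :: "'a::euclidean_space set"
  assumes "y \<in> closest_points E x" "y' \<in> closest_points E x'"
  shows "(x - x') \<bullet> (y - y') \<ge> 0"
proof -
  have yE: "y \<in> E" "y' \<in> E" and d: "dist x y = infdist x E" "dist x' y' = infdist x' E"
    using assms by (auto simp: closest_points_def)
  have "dist x y \<le> dist x y'" "dist x' y' \<le> dist x' y"
    using d yE by (auto intro: infdist_le)
  then have "(x - y) \<bullet> (x - y) \<le> (x - y') \<bullet> (x - y')" "(x' - y') \<bullet> (x' - y') \<le> (x' - y) \<bullet> (x' - y)"
    by (auto simp: dist_norm norm_le)
  then show ?thesis
    by (simp add: inner_diff inner_commute algebra_simps)
qed

lemma spanning_inner_lower_bound:
  fixes T :: "'a::euclidean_space set"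
  assumes "finite T" "span T = UNIV"
  shows "\<exists>c>0. \<forall>w. c * norm w \<le> (\<Sum>t\<in>T. \<bar>w \<bullet> t\<bar>)"
proof -
  define h where "h w = (\<Sum>t\<in>T. \<bar>w \<bullet> t\<bar>)" for w
  have cont: "continuous_on (sphere 0 1) h"
    unfolding h_def by (intro continuous_intros)
  have "sphere (0::'a) 1 \<noteq> {}" by simp
  then obtain u where u: "u \<in> sphere 0 1" and min: "\<And>v. v \<in> sphere 0 1 \<Longrightarrow> h u \<le> h v"
    using continuous_attains_inf[OF compact_sphere _ cont] by blast
  have "h u \<noteq> 0"
  proof
    assume "h u = 0"
    then have "\<And>t. t \<in> T \<Longrightarrow> t \<bullet> u = 0"
      using \<open>finite T\<close> by (simp add: h_def sum_nonneg_eq_0_iff inner_commute)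
    then have "u \<in> (span T)\<^sup>\<bottom>" 
      by (simp add: orthogonal_comp_def orthogonal_def) (metis inner_commute orthogonal_def orthogonal_to_span)
    then have "u \<bullet> u = 0" using assms by (auto simp: orthogonal_comp_def orthogonal_def)
    with u show False by simp
  qed
  moreover have "h u \<ge> 0" unfolding h_def by (simp add: sum_nonneg)
  ultimately have pos: "h u > 0" by simp
  have "h u * norm w \<le> h w" for w
  proof (cases "w = 0")
    case False
    have "h u \<le> h (w /\<^sub>R norm w)" by (rule min) (use False in simp)
    also have "\<dots> = h w / norm w"
      by (simp add: h_def abs_mult sum_distrib_left divide_inverse mult.commute)
    finally show ?thesis using False by (simp add: field_simps)
  qed (simp add: h_def)
  with pos show ?thesis unfolding h_def by blast
qed

text \<open>
  The set \<open>J\<close> completes the differences of points of \<open>A\<close> to a basis. A vector that is nearly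
  orthogonal to these differences is then controlled by its coordinates in \<open>J\<close>.
\<close>

lemma affine_independent_complement:
  fixes A :: "'a::euclidean_space set"
  assumes "finite A" "A \<noteq> {}" "\<not> affine_dependent A"
  shows "\<exists>J\<subseteq>Basis. card J = DIM('a) + 1 - card A \<and>
    (\<exists>\<epsilon>>0. \<exists>C\<ge>0. \<forall>w. (\<forall>a\<in>A. \<forall>b\<in>A. \<bar>w \<bullet> (a - b)\<bar> \<le> \<epsilon> * norm w)
      \<longrightarrow> norm w \<le> C * (\<Sum>b\<in>J. \<bar>w \<bullet> b\<bar>))"
proof -
  obtain a where a: "a \<in> A" using assms by blast
  define B where "B = (\<lambda>x. x - a) ` (A - {a})"
  have "independent B"
    using assms(3) affine_dependent_iff_dependent2[OF a] by (simp add: B_def)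
  have finB: "finite B" using assms by (simp add: B_def)
  have cardB: "card B = card A - 1"
    unfolding B_def using a assms(1) by (subst card_image) (auto simp: inj_on_def)
  obtain T where BT: "B \<subseteq> T" "T \<subseteq> B \<union> Basis" and "independent T" and "B \<union> Basis \<subseteq> span T"
    using maximal_independent_subset_extend[of B "B \<union> Basis"] \<open>independent B\<close> by blast
  then have "span T = UNIV"
    by (metis Un_subset_iff span_Basis span_mono span_span top.extremum_uniqueI)
  then have cardT: "card T = DIM('a)"
    using \<open>independent T\<close> by (metis dim_UNIV dim_eq_card_independent dim_span)
  have T: "card T = DIM('a)" "finite T" "B \<subseteq> T" "T \<subseteq> B \<union> Basis"
    using cardT BT finB finite_subset[OF BT(2)] by auto
  then obtain c where c: "c > 0" "\<And>w. c * norm w \<le> (\<Sum>t\<in>T. \<bar>w \<bullet> t\<bar>)"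
    using spanning_inner_lower_bound[OF T(2) \<open>span T = UNIV\<close>] by blast
  define J where "J = T - B"
  have JB: "J \<subseteq> Basis" using T by (auto simp: J_def)
  have "card A \<ge> 1" using assms by (simp add: Suc_leI card_gt_0_iff)
  then have cardJ: "card J = DIM('a) + 1 - card A"
    unfolding J_def using T finB cardB by (simp add: card_Diff_subset)
  \<comment> \<open>The vectors in \<open>B\<close>, fewer than \<open>card A\<close> in number, then contribute at most half of the
    lower bound \<open>c * norm w\<close>.\<close>
  define \<epsilon> where "\<epsilon> = c / (2 * real (card A))"
  have eps: "\<epsilon> > 0" using c \<open>card A \<ge> 1\<close> by (simp add: \<epsilon>_def)
  have "norm w \<le> 2 / c * (\<Sum>b\<in>J. \<bar>w \<bullet> b\<bar>)"
    if w: "\<forall>a\<in>A. \<forall>b\<in>A. \<bar>w \<bullet> (a - b)\<bar> \<le> \<epsilon> * norm w" for w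
  proof -
    have "(\<Sum>t\<in>B. \<bar>w \<bullet> t\<bar>) \<le> (\<Sum>t\<in>B. \<epsilon> * norm w)"
      by (rule sum_mono) (use w a in \<open>auto simp: B_def\<close>)
    also have "\<dots> = real (card B) * (\<epsilon> * norm w)" by simp
    also have "\<dots> \<le> real (card A) * (\<epsilon> * norm w)"
      using cardB eps by (intro mult_right_mono) auto
    also have "\<dots> = c / 2 * norm w" using \<open>card A \<ge> 1\<close> by (simp add: \<epsilon>_def)
    finally have "(\<Sum>t\<in>B. \<bar>w \<bullet> t\<bar>) \<le> c / 2 * norm w" .
    moreover have "(\<Sum>t\<in>T. \<bar>w \<bullet> t\<bar>) = (\<Sum>t\<in>J. \<bar>w \<bullet> t\<bar>) + (\<Sum>t\<in>B. \<bar>w \<bullet> t\<bar>)"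
      unfolding J_def using T by (metis sum.subset_diff)
    ultimately have "c / 2 * norm w \<le> (\<Sum>b\<in>J. \<bar>w \<bullet> b\<bar>)" using c(2)[of w] by simp
    then show ?thesis using c(1) by (simp add: field_simps)
  qed
  moreover have "2 / c \<ge> 0" using c by simp
  ultimately show ?thesis using JB cardJ eps by blast
qed

text \<open>
  The set \<open>J\<close> and the constant \<open>C\<close> may differ between the members of the family, but there are
  only countably many members.
\<close>

lemma medial_axis_countable_cover:
  fixes E :: "'a::euclidean_space set"
  assumes "1 \<le> k"
  shows "\<exists>\<F>. countable \<F> \<and> medial_axis k E \<subseteq> \<Union>\<F> \<and>
    (\<forall>S\<in>\<F>. \<exists>J C. J \<subseteq> Basis \<and> card J = DIM('a) + 1 - k \<and> C \<ge> 0 \<and> coord_graph J C S)"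
proof -
  obtain D :: "'a set" where D: "countable D" "\<And>X. open X \<Longrightarrow> X \<noteq> {} \<Longrightarrow> \<exists>d\<in>D. d \<in> X"
    using countable_dense_exists by metis
  define P where "P Q N = {x. \<forall>q\<in>Q. \<exists>y\<in>closest_points E x. dist y q < 1 / real (Suc N)}"
    for Q :: "'a set" and N :: nat
  define \<F> where "\<F> = {S \<in> (\<lambda>(Q, N). P Q N) ` ({Q. finite Q \<and> Q \<subseteq> D} \<times> UNIV).
    \<exists>J C. J \<subseteq> Basis \<and> card J = DIM('a) + 1 - k \<and> C \<ge> 0 \<and> coord_graph J C S}"
  have "countable {Q. finite Q \<and> Q \<subseteq> D}"
    by (rule countable_Collect_finite_subset[OF D(1)])
  then have "countable ((\<lambda>(Q, N). P Q N) ` ({Q. finite Q \<and> Q \<subseteq> D} \<times> UNIV))"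
    by (intro countable_image countable_SIGMA) auto
  then have "countable \<F>"
    by (rule countable_subset[rotated]) (auto simp: \<F>_def)
  moreover have "x \<in> \<Union>\<F>" if x: "x \<in> medial_axis k E" for x
  proof -
    obtain A where A: "A \<subseteq> closest_points E x" "finite A" "card A = k" "\<not> affine_dependent A"
      using x unfolding medial_axis_def by blast
    have "A \<noteq> {}" using A assms by auto
    obtain J \<epsilon> C where J: "J \<subseteq> Basis" "card J = DIM('a) + 1 - k" and eps: "\<epsilon> > 0" and C: "C \<ge> 0"
      and bd: "\<And>w. (\<forall>a\<in>A. \<forall>b\<in>A. \<bar>w \<bullet> (a - b)\<bar> \<le> \<epsilon> * norm w) \<Longrightarrow> norm w \<le> C * (\<Sum>b\<in>J. \<bar>w \<bullet> b\<bar>)"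
      using affine_independent_complement[OF A(2) \<open>A \<noteq> {}\<close> A(4)] A(3) by blast
    obtain N where N: "1 / real (Suc N) < \<epsilon> / 4"
      using reals_Archimedean[of "\<epsilon> / 4"] eps by (auto simp: inverse_eq_divide)
    define r where "r = 1 / real (Suc N)"
    have r: "r > 0" "4 * r \<le> \<epsilon>" using N by (auto simp: r_def)
    have "\<exists>q. q \<in> D \<and> dist a q < r" for a
      using D(2)[of "ball a r"] r by auto
    then obtain q where q: "\<And>a. q a \<in> D" "\<And>a. dist a (q a) < r" by metis
    have xP: "x \<in> P (q ` A) N"
      using A(1) q(2) by (auto simp: P_def r_def)
    \<comment> \<open>Exchanging \<open>a\<close> and \<open>b\<close> in this one-sided bound gives the bound on the absolute value.\<close>
    have half: "(u - v) \<bullet> (a - b) \<ge> - (\<epsilon> * norm (u - v))"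
      if uv: "u \<in> P (q ` A) N" "v \<in> P (q ` A) N" and ab: "a \<in> A" "b \<in> A" for u v a b
    proof -
      obtain y where y: "y \<in> closest_points E u" "dist y (q a) < r"
        using uv(1) ab(1) by (auto simp: P_def r_def)
      obtain z where z: "z \<in> closest_points E v" "dist z (q b) < r"
        using uv(2) ab(2) by (auto simp: P_def r_def)
      have "norm ((a - b) - (y - z)) \<le> norm (a - y) + norm (b - z)"
        using norm_triangle_ineq4[of "a - y" "b - z"] by (simp add: algebra_simps)
      also have "\<dots> \<le> \<epsilon>"
      proof -
        have "dist a y < 2 * r" using y(2) q(2)[of a] dist_triangle2[of a y "q a"] by simp
        moreover have "dist b z < 2 * r" using z(2) q(2)[of b] dist_triangle2[of b z "q b"] by simp
        ultimately show ?thesis using r by (simp add: dist_norm)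
      qed
      finally have "\<bar>(u - v) \<bullet> ((a - b) - (y - z))\<bar> \<le> norm (u - v) * \<epsilon>"
        using Cauchy_Schwarz_ineq2[of "u - v" "(a - b) - (y - z)"]
        by (meson mult_left_mono norm_ge_zero order_trans)
      moreover have "(u - v) \<bullet> (y - z) \<ge> 0" using closest_points_monotone y z by blast
      ultimately show ?thesis by (simp add: inner_diff_right mult.commute)
    qed
    have "coord_graph J C (P (q ` A) N)"
      unfolding coord_graph_def
    proof (intro ballI bd)
      fix u v a b
      assume uv: "u \<in> P (q ` A) N" "v \<in> P (q ` A) N" and ab: "a \<in> A" "b \<in> A"
      have "(u - v) \<bullet> (b - a) = - ((u - v) \<bullet> (a - b))"
        by (simp add: inner_diff_right)
      then show "\<bar>(u - v) \<bullet> (a - b)\<bar> \<le> \<epsilon> * norm (u - v)"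
        using half[OF uv ab] half[OF uv ab(2,1)] by linarith
    qed
    moreover have "P (q ` A) N \<in> (\<lambda>(Q, N). P Q N) ` ({Q. finite Q \<and> Q \<subseteq> D} \<times> UNIV)"
      using A(2) q(1) by force
    ultimately have "P (q ` A) N \<in> \<F>" using J C by (auto simp: \<F>_def)
    with xP show ?thesis by blast
  qed
  ultimately show ?thesis
    by (intro exI[of _ \<F>]) (auto simp: \<F>_def)
qed

section \<open>Lipschitz parametrisation\<close>

text \<open>
  McShane's extension of a real Lipschitz function \<open>g \<circ> p\<^sup>-\<^sup>1\<close> given on \<open>p ` S\<close>, for a pseudometric
  \<open>D\<close>: the extension is the infimum of the functions \<open>\<lambda>u. g s + L * D u (p s)\<close>. Here \<open>D\<close> will be the
  Euclidean distance in the first \<open>m\<close> coordinates, which does not separate all sequences.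
\<close>

lemma mcshane_extension:
  fixes D :: "'b \<Rightarrow> 'b \<Rightarrow> real" and p :: "'a \<Rightarrow> 'b" and g :: "'a \<Rightarrow> real"
  assumes "L \<ge> 0"
    and D: "\<And>u. D u u = 0" "\<And>u v. D u v = D v u" "\<And>u v w. D u w \<le> D u v + D v w"
    and lip: "\<And>x y. x \<in> S \<Longrightarrow> y \<in> S \<Longrightarrow> \<bar>g x - g y\<bar> \<le> L * D (p x) (p y)"
  shows "\<exists>F. (\<forall>u v. \<bar>F u - F v\<bar> \<le> L * D u v) \<and> (\<forall>x\<in>S. F (p x) = g x)"
proof (cases "S = {}")
  case True
  have "D u v \<ge> 0" for u v using D(1)[of u] D(2)[of u v] D(3)[of u u v] by simp
  then show ?thesis using True \<open>L \<ge> 0\<close> by (intro exI[of _ "\<lambda>_. 0"]) simp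
next
  case False
  define F where "F u = (INF s\<in>S. g s + L * D u (p s))" for u
  have LD: "L * D u w \<le> L * D u v + L * D v w" for u v w
    using mult_left_mono[OF D(3) \<open>L \<ge> 0\<close>, of u w v] by (simp add: algebra_simps)
  have bdd: "bdd_below ((\<lambda>s. g s + L * D u (p s)) ` S)" for u
  proof -
    obtain t where t: "t \<in> S" using False by blast
    have "g t - L * D (p t) u \<le> g s + L * D u (p s)" if "s \<in> S" for s
      using lip[OF t that] LD[of "p t" "p s" u] by linarith
    then show ?thesis by (meson bdd_belowI2)
  qed
  have "F u \<le> F v + L * D u v" for u v
  proof -
    have "F u - L * D u v \<le> g s + L * D v (p s)" if "s \<in> S" for s
      using cINF_lower[OF bdd[of u] that] LD[of u "p s" v] unfolding F_def by linarith
    then have "F u - L * D u v \<le> F v"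
      unfolding F_def[of v] by (rule cINF_greatest[OF False])
    then show ?thesis by simp
  qed
  note one_sided = this
  have "\<bar>F u - F v\<bar> \<le> L * D u v" for u v
    using one_sided[of u v] one_sided[of v u] D(2)[of u v] by auto
  moreover have "F (p x) = g x" if "x \<in> S" for x
  proof (rule antisym)
    show "F (p x) \<le> g x"
      using cINF_lower[OF bdd[of "p x"] that] D(1) unfolding F_def by simp
    show "g x \<le> F (p x)"
      unfolding F_def
    proof (rule cINF_greatest[OF False])
      fix s assume "s \<in> S"
      then show "g x \<le> g s + L * D (p x) (p s)" using lip[OF that \<open>s \<in> S\<close>] by linarith
    qed
  qed
  ultimately show ?thesis by blast
qed

lemma L2_set_diff_triangle:
  "L2_set (\<lambda>i. u i - w i) A \<le> L2_set (\<lambda>i. u i - v i) A + L2_set (\<lambda>i. v i - w i) A"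
  using L2_set_triangle_ineq[of "\<lambda>i. u i - v i" "\<lambda>i. v i - w i" A] by simp

lemma coord_graph_Lipschitz_image:
  fixes S :: "'a::euclidean_space set"
  assumes J: "J \<subseteq> Basis" "card J = m" and "C \<ge> 0" and S: "coord_graph J C S"
  shows "\<exists>f. lipschitz_from_Rm m f \<and> S \<subseteq> f ` topspace (Euclidean_space m)"
proof -
  have "finite J" using J finite_subset finite_Basis by blast
  then obtain \<beta> where \<beta>: "bij_betw \<beta> {..<m} J"
    using J(2) bij_betw_from_nat_into_finite by (metis ex_bij_betw_nat_finite atLeast0LessThan)
  define p where "p x = (\<lambda>i. if i < m then x \<bullet> \<beta> i else 0)" for x
  define D where "D u v = L2_set (\<lambda>i. u i - v i) {..<m}" for u v :: "nat \<Rightarrow> real"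
  have D0: "D u u = 0" and Dsym: "D u v = D v u" and Dtri: "D u w \<le> D u v + D v w" for u v w
    unfolding D_def using L2_set_diff_triangle[of u w "{..<m}" v]
    by (auto simp: L2_set_def power2_commute[of "u _"])
  have Dnn: "D u v \<ge> 0" for u v by (simp add: D_def)
  have Sp: "norm (x - y) \<le> (C * m) * D (p x) (p y)" if "x \<in> S" "y \<in> S" for x y
  proof -
    have "(\<Sum>b\<in>J. \<bar>(x - y) \<bullet> b\<bar>) = (\<Sum>i<m. \<bar>(x - y) \<bullet> \<beta> i\<bar>)"
      by (rule sum.reindex_bij_betw[OF \<beta>, symmetric])
    also have "\<dots> \<le> (\<Sum>i<m. D (p x) (p y))"
    proof (rule sum_mono)
      fix i assume "i \<in> {..<m}"
      then have "\<bar>(x - y) \<bullet> \<beta> i\<bar> = \<bar>p x i - p y i\<bar>" by (simp add: p_def inner_diff_left)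
      also have "\<dots> \<le> L2_set (\<lambda>i. \<bar>p x i - p y i\<bar>) {..<m}"
        using member_le_L2_set[of "{..<m}" i "\<lambda>i. \<bar>p x i - p y i\<bar>"] \<open>i \<in> {..<m}\<close> by simp
      also have "\<dots> = D (p x) (p y)" by (simp add: D_def L2_set_def)
      finally show "\<bar>(x - y) \<bullet> \<beta> i\<bar> \<le> D (p x) (p y)" .
    qed
    also have "\<dots> = m * D (p x) (p y)" by simp
    finally have "C * (\<Sum>b\<in>J. \<bar>(x - y) \<bullet> b\<bar>) \<le> C * (m * D (p x) (p y))"
      using \<open>C \<ge> 0\<close> by (rule mult_left_mono)
    then show ?thesis using S that unfolding coord_graph_def by fastforce
  qed
  have "\<exists>F. (\<forall>u v. \<bar>F u - F v\<bar> \<le> (C * m) * D u v) \<and> (\<forall>x\<in>S. F (p x) = x \<bullet> e)"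
    if "e \<in> Basis" for e
  proof (rule mcshane_extension)
    fix x y assume "x \<in> S" "y \<in> S"
    then show "\<bar>x \<bullet> e - y \<bullet> e\<bar> \<le> (C * m) * D (p x) (p y)"
      using Sp[of x y] Basis_le_norm[OF that, of "x - y"] by (simp add: inner_diff_left)
    next
    show "D u w \<le> D u v + D v w" for u v w by (rule Dtri)
  qed (use \<open>C \<ge> 0\<close> D0 Dsym in auto)
  then obtain F where F: "\<And>e u v. e \<in> Basis \<Longrightarrow> \<bar>F e u - F e v\<bar> \<le> (C * m) * D u v"
    "\<And>e x. e \<in> Basis \<Longrightarrow> x \<in> S \<Longrightarrow> F e (p x) = x \<bullet> e"
    by metis
  define f where "f u = (\<Sum>e\<in>Basis. F e u *\<^sub>R e)" for u :: "nat \<Rightarrow> real"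
  have "dist (f u) (f v) \<le> (DIM('a) * (C * m)) * D u v" for u v
  proof -
    have "dist (f u) (f v) \<le> (\<Sum>e\<in>Basis. \<bar>(f u - f v) \<bullet> e\<bar>)"
      unfolding dist_norm by (rule norm_le_l1)
    also have "\<dots> \<le> (\<Sum>e\<in>(Basis::'a set). (C * m) * D u v)"
      by (rule sum_mono) (use F(1) in \<open>simp add: f_def inner_diff_left\<close>)
    finally show ?thesis by simp
  qed
  then have "lipschitz_from_Rm m f"
    unfolding lipschitz_from_Rm_def using \<open>C \<ge> 0\<close>
    by (intro exI[of _ "DIM('a) * (C * m)"]) (auto simp: D_def)
  moreover have "x \<in> f ` topspace (Euclidean_space m)" if "x \<in> S" for x
  proof
    show "x = f (p x)" using F(2) that by (simp add: f_def euclidean_representation)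
    show "p x \<in> topspace (Euclidean_space m)" by (simp add: p_def topspace_Euclidean_space)
  qed
  ultimately show ?thesis by blast
qed

section \<open>Null sets of Hausdorff measures\<close>

lemma hausdorff_measure_eq_0_iff:
  "hausdorff_measure s S = 0 \<longleftrightarrow>
    (\<forall>\<delta>>0. \<forall>\<epsilon>>0. \<exists>U :: nat \<Rightarrow> _. S \<subseteq> (\<Union>i. U i) \<and>
      (\<forall>i. bounded (U i) \<and> diameter (U i) \<le> \<delta>) \<and> (\<Sum>i. diam_pow s (U i)) \<le> ennreal \<epsilon>)"
  (is "?L \<longleftrightarrow> ?R")
proof
  assume L: ?L
  show ?R
  proof (intro allI impI)
    fix \<delta> \<epsilon> :: real assume "\<delta> > 0" "\<epsilon> > 0"
    have "hausdorff_premeasure s \<delta> S \<le> 0"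
      using L \<open>\<delta> > 0\<close> unfolding hausdorff_measure_def by (metis SUP_upper greaterThan_iff)
    also have "0 < ennreal \<epsilon>" using \<open>\<epsilon> > 0\<close> by simp
    finally show "\<exists>U :: nat \<Rightarrow> _. S \<subseteq> (\<Union>i. U i) \<and>
      (\<forall>i. bounded (U i) \<and> diameter (U i) \<le> \<delta>) \<and> (\<Sum>i. diam_pow s (U i)) \<le> ennreal \<epsilon>"
      unfolding hausdorff_premeasure_def INF_less_iff by (auto intro: less_imp_le)
  qed
next
  assume R: ?R
  have "hausdorff_premeasure s \<delta> S \<le> 0" if \<delta>: "\<delta> > 0" for \<delta>
  proof (rule ennreal_le_epsilon)
    fix \<epsilon> :: real assume "\<epsilon> > 0"
    then obtain U :: "nat \<Rightarrow> _" where "S \<subseteq> (\<Union>i. U i)" 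
      "\<forall>i. bounded (U i) \<and> diameter (U i) \<le> \<delta>" "(\<Sum>i. diam_pow s (U i)) \<le> ennreal \<epsilon>"
      using R \<delta> by blast
    then show "hausdorff_premeasure s \<delta> S \<le> 0 + ennreal \<epsilon>"
      unfolding hausdorff_premeasure_def by (auto intro: INF_lower2)
  qed
  then show ?L unfolding hausdorff_measure_def
    by (intro antisym SUP_least) auto
qed

lemma hausdorff_null_subset:
  "hausdorff_measure s T = 0 \<Longrightarrow> S \<subseteq> T \<Longrightarrow> hausdorff_measure s S = 0"
  unfolding hausdorff_measure_eq_0_iff by (meson order_trans)

lemma hausdorff_null_empty: "hausdorff_measure s {} = 0"
  unfolding hausdorff_measure_eq_0_iff
  by (intro allI impI exI[of _ "\<lambda>_. {}"]) (auto simp: diam_pow_def diameter_def)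

lemma hausdorff_null_UN:
  fixes S :: "nat \<Rightarrow> 'a::metric_space set"
  assumes "\<And>i. hausdorff_measure s (S i) = 0"
  shows "hausdorff_measure s (\<Union>i. S i) = 0"
  unfolding hausdorff_measure_eq_0_iff
proof (intro allI impI)
  fix \<delta> \<epsilon> :: real assume "\<delta> > 0" "\<epsilon> > 0"
  then have "\<exists>U :: nat \<Rightarrow> _. S i \<subseteq> (\<Union>j. U j) \<and> (\<forall>j. bounded (U j) \<and> diameter (U j) \<le> \<delta>) \<and>
      (\<Sum>j. diam_pow s (U j)) \<le> ennreal (\<epsilon> * (1 / 2) ^ Suc i)" for i
    using assms[of i] unfolding hausdorff_measure_eq_0_iff by simp
  then obtain U :: "nat \<Rightarrow> nat \<Rightarrow> 'a set" where U: "\<And>i. S i \<subseteq> (\<Union>j. U i j)"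
    "\<And>i j. bounded (U i j)" "\<And>i j. diameter (U i j) \<le> \<delta>"
    "\<And>i. (\<Sum>j. diam_pow s (U i j)) \<le> ennreal (\<epsilon> * (1 / 2) ^ Suc i)"
    by metis
  define V where "V n = case_prod U (prod_decode n)" for n
  have "(\<Sum>n. diam_pow s (V n)) = (\<Sum>i. \<Sum>j. diam_pow s (U i j))"
    using suminf_ennreal_2dimen[of "\<lambda>i. \<Sum>j. diam_pow s (U i j)" "\<lambda>(i, j). diam_pow s (U i j)"]
    by (simp add: V_def case_prod_unfold comp_def)
  also have "\<dots> \<le> (\<Sum>i. ennreal (\<epsilon> * (1 / 2) ^ Suc i))"
    by (intro suminf_le U) auto
  also have "\<dots> = ennreal \<epsilon>"
    using sums_mult[OF power_half_series, of \<epsilon>] \<open>\<epsilon> > 0\<close>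
    by (intro suminf_ennreal_eq) auto
  finally have "(\<Sum>n. diam_pow s (V n)) \<le> ennreal \<epsilon>" .
  moreover have "(\<Union>i. S i) \<subseteq> (\<Union>n. V n)"
  proof
    fix x assume "x \<in> (\<Union>i. S i)"
    then obtain i j where "x \<in> U i j" using U(1) by blast
    then have "x \<in> V (prod_encode (i, j))" by (simp add: V_def)
    then show "x \<in> (\<Union>n. V n)" by blast
  qed
  moreover have "\<forall>n. bounded (V n) \<and> diameter (V n) \<le> \<delta>"
    using U by (simp add: V_def case_prod_unfold)
  ultimately show "\<exists>V :: nat \<Rightarrow> _. (\<Union>i. S i) \<subseteq> (\<Union>i. V i) \<and>
      (\<forall>i. bounded (V i) \<and> diameter (V i) \<le> \<delta>) \<and> (\<Sum>i. diam_pow s (V i)) \<le> ennreal \<epsilon>"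
    by blast
qed

lemma hausdorff_null_Union:
  assumes "countable \<F>" "\<And>S. S \<in> \<F> \<Longrightarrow> hausdorff_measure s S = 0"
  shows "hausdorff_measure s (\<Union>\<F>) = 0"
proof (cases "\<F> = {}")
  case False
  have "hausdorff_measure s (\<Union>i. from_nat_into \<F> i) = 0"
    using assms(2) False by (intro hausdorff_null_UN) (simp add: from_nat_into)
  then show ?thesis using range_from_nat_into[OF False assms(1)] by simp
qed (simp add: hausdorff_null_empty)

section \<open>Dimension of graphs\<close>

text \<open>
  With \<open>m = card J\<close>, the \<open>(2 * N * K) ^ m\<close> cubes of side \<open>1 / K\<close> that make up the cube of side
  \<open>2 * N\<close> cut \<open>S\<close> into parts of diameter at most \<open>C * m / K\<close>. The resulting sum is a constant times
  \<open>K powr (m - s)\<close>, which tends to \<open>0\<close>.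
\<close>

lemma coord_graph_bounded_null:
  fixes S :: "'a::euclidean_space set"
  assumes "finite J" "C \<ge> 0" "coord_graph J C S" and s: "real (card J) < s"
    and N: "\<And>x b. x \<in> S \<Longrightarrow> b \<in> J \<Longrightarrow> \<bar>x \<bullet> b\<bar> < real N"
  shows "hausdorff_measure s S = 0"
  unfolding hausdorff_measure_eq_0_iff
proof (intro allI impI)
  fix \<delta> \<epsilon> :: real assume "\<delta> > 0" "\<epsilon> > 0"
  define m where "m = card J"
  define c where "c = C * m"
  have c: "c \<ge> 0" using \<open>C \<ge> 0\<close> by (simp add: c_def)
  have s0: "s > 0" using s by (simp add: le_less_trans[of 0 "real (card J)"])
  have "(\<lambda>K. c / real K) \<longlonglongrightarrow> 0" by (rule lim_const_over_n)
  then have ev1: "\<forall>\<^sub>F K in sequentially. c / real K < \<delta>"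
    using \<open>\<delta> > 0\<close> by (rule order_tendstoD)
  have "(\<lambda>K. real K powr (real m - s)) \<longlonglongrightarrow> 0"
    using s by (intro tendsto_neg_powr filterlim_real_sequentially) (simp add: m_def)
  then have "(\<lambda>K. ((2 * real N) ^ m * c powr s) * real K powr (real m - s)) \<longlonglongrightarrow> 0"
    by (rule tendsto_mult_right_zero)
  then have ev2: "\<forall>\<^sub>F K in sequentially. ((2 * real N) ^ m * c powr s) * real K powr (real m - s) < \<epsilon>"
    using \<open>\<epsilon> > 0\<close> by (rule order_tendstoD)
  obtain K :: nat where K: "K > 0" "c / real K < \<delta>"
    "((2 * real N) ^ m * c powr s) * real K powr (real m - s) < \<epsilon>"
    using eventually_happens[OF eventually_conj[OF eventually_gt_at_top[of 0] eventually_conj[OF ev1 ev2]]]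
    by auto
  have Keq: "((2 * real N) ^ m * c powr s) * real K powr (real m - s)
      = real ((2 * N * K) ^ m) * (c / K) powr s"
    using K(1) c by (simp add: powr_diff powr_divide powr_realpow power_mult_distrib)
  define Z where "Z = J \<rightarrow>\<^sub>E {- int (N * K)..<int (N * K)}"
  define V where "V z = {x \<in> S. \<forall>b\<in>J. \<lfloor>real K * (x \<bullet> b)\<rfloor> = z b}" for z
  have "finite Z" unfolding Z_def by (intro finite_PiE \<open>finite J\<close>) simp
  have cardZ: "card Z = (2 * N * K) ^ m"
  proof -
    have "card {- int (N * K)..<int (N * K)} = 2 * N * K"
      by (simp del: of_nat_mult)
    then show ?thesis using \<open>finite J\<close> unfolding Z_def m_def by (simp add: card_PiE)
  qed
  have Vdist: "dist x y \<le> c / K" if "x \<in> V z" "y \<in> V z" for x y z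
  proof -
    have "\<bar>(x - y) \<bullet> b\<bar> \<le> 1 / K" if "b \<in> J" for b
    proof -
      have "\<lfloor>real K * (x \<bullet> b)\<rfloor> = \<lfloor>real K * (y \<bullet> b)\<rfloor>"
        using \<open>x \<in> V z\<close> \<open>y \<in> V z\<close> that by (simp add: V_def)
      then have "\<bar>real K * (x \<bullet> b) - real K * (y \<bullet> b)\<bar> \<le> 1" by linarith
      then have "real K * \<bar>(x - y) \<bullet> b\<bar> \<le> 1"
        by (simp add: inner_diff_left abs_mult flip: right_diff_distrib)
      then show ?thesis using K(1) by (simp add: field_simps)
    qed
    then have "(\<Sum>b\<in>J. \<bar>(x - y) \<bullet> b\<bar>) \<le> m * (1 / K)"
      unfolding m_def by (intro sum_bounded_above) auto
    then have "C * (\<Sum>b\<in>J. \<bar>(x - y) \<bullet> b\<bar>) \<le> c / K"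
      using mult_left_mono[OF _ \<open>C \<ge> 0\<close>] by (fastforce simp: c_def)
    moreover have "norm (x - y) \<le> C * (\<Sum>b\<in>J. \<bar>(x - y) \<bullet> b\<bar>)"
      using assms(3) that by (auto simp: coord_graph_def V_def)
    ultimately show ?thesis by (simp add: dist_norm)
  qed
  have Vb: "bounded (V z)" for z
    unfolding bounded_two_points using Vdist by blast
  have Vd: "diameter (V z) \<le> c / K" for z
    using Vdist c by (intro diameter_le) (auto simp: dist_norm)
  have Vp: "diam_pow s (V z) \<le> ennreal ((c / K) powr s)" for z
    using s0 Vd Vb diameter_ge_0
    by (auto simp: diam_pow_def intro!: ennreal_leI powr_mono2)
  obtain h where h: "bij_betw h {..<card Z} Z"
    using ex_bij_betw_nat_finite[OF \<open>finite Z\<close>] by (auto simp: atLeast0LessThan)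
  define U where "U i = (if i < card Z then V (h i) else {})" for i
  have "S \<subseteq> (\<Union>i. U i)"
  proof
    fix x assume x: "x \<in> S"
    define z where "z = (\<lambda>b\<in>J. \<lfloor>real K * (x \<bullet> b)\<rfloor>)"
    have "\<lfloor>real K * (x \<bullet> b)\<rfloor> \<in> {- int (N * K)..<int (N * K)}" if "b \<in> J" for b
    proof -
      have "real K * \<bar>x \<bullet> b\<bar> < real K * real N" using N[OF x that] K(1) by simp
      then have "\<bar>real K * (x \<bullet> b)\<bar> < real (N * K)" by (simp add: abs_mult mult.commute)
      then show ?thesis
        unfolding atLeastLessThan_iff le_floor_iff floor_less_iff by (simp add: abs_less_iff)
    qed
    then have "z \<in> Z" by (auto simp: z_def Z_def)
    then obtain i where "i < card Z" "h i = z"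
      using bij_betw_imp_surj_on[OF h] by (metis imageE lessThan_iff)
    moreover have "x \<in> V z" using x by (simp add: V_def z_def)
    ultimately show "x \<in> (\<Union>i. U i)" by (auto simp: U_def)
  qed
  moreover have "bounded (U i) \<and> diameter (U i) \<le> \<delta>" for i
    using Vb order_trans[OF Vd less_imp_le[OF K(2)]] \<open>\<delta> > 0\<close> by (auto simp: U_def)
  moreover have "(\<Sum>i. diam_pow s (U i)) \<le> ennreal \<epsilon>"
  proof -
    have "(\<Sum>i. diam_pow s (U i)) = (\<Sum>i<card Z. diam_pow s (U i))"
      by (rule suminf_finite) (auto simp: U_def diam_pow_def)
    also have "\<dots> \<le> (\<Sum>i<card Z. ennreal ((c / K) powr s))"
      by (rule sum_mono) (simp add: U_def Vp)
    also have "\<dots> = ennreal (real (card Z) * (c / K) powr s)"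
      by (simp add: ennreal_mult ennreal_of_nat_eq_real_of_nat)
    also have "\<dots> \<le> ennreal \<epsilon>"
      unfolding cardZ using K(3) Keq by (intro ennreal_leI) linarith
    finally show ?thesis .
  qed
  ultimately show "\<exists>U :: nat \<Rightarrow> _. S \<subseteq> (\<Union>i. U i) \<and>
      (\<forall>i. bounded (U i) \<and> diameter (U i) \<le> \<delta>) \<and> (\<Sum>i. diam_pow s (U i)) \<le> ennreal \<epsilon>"
    by blast
qed

lemma coord_graph_null:
  fixes S :: "'a::euclidean_space set"
  assumes "J \<subseteq> Basis" "C \<ge> 0" "coord_graph J C S" "real (card J) < s"
  shows "hausdorff_measure s S = 0"
proof -
  have "hausdorff_measure s (S \<inter> ball 0 (real N)) = 0" for N
  proof (rule coord_graph_bounded_null)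
    show "\<bar>x \<bullet> b\<bar> < real N" if "x \<in> S \<inter> ball 0 (real N)" "b \<in> J" for x b
      using Basis_le_norm[of b x] that assms(1) by force
  qed (use assms finite_subset[OF _ finite_Basis] in \<open>auto simp: coord_graph_def\<close>)
  then have "hausdorff_measure s (\<Union>N. S \<inter> ball 0 (real N)) = 0"
    by (rule hausdorff_null_UN)
  then show ?thesis
    by (rule hausdorff_null_subset) (auto simp: reals_Archimedean2)
qed

lemma hausdorff_dimension_leI:
  assumes "\<And>s. real m < s \<Longrightarrow> hausdorff_measure s S = 0"
  shows "hausdorff_dimension S \<le> of_nat m"
proof (rule ennreal_le_epsilon)
  fix e :: real assume "e > 0"
  then have "hausdorff_dimension S \<le> ennreal (real m + e)"
    unfolding hausdorff_dimension_def using assms[of "real m + e"] by (intro INF_lower) auto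
  then show "hausdorff_dimension S \<le> of_nat m + ennreal e"
    using \<open>e > 0\<close> by (simp add: ennreal_of_nat_eq_real_of_nat)
qed

section \<open>Rectifiability and dimension of the medial axis\<close>

lemma rectifiable_coord_graphs:
  fixes S :: "'a::euclidean_space set"
  assumes "countable \<F>" "S \<subseteq> \<Union>\<F>"
    and \<F>: "\<And>T. T \<in> \<F> \<Longrightarrow> \<exists>J C. J \<subseteq> Basis \<and> card J = m \<and> C \<ge> 0 \<and> coord_graph J C T"
  shows "rectifiable m S"
proof (cases "m = 0")
  case True
  have "countable T" if T: "T \<in> \<F>" for T
  proof -
    obtain J C where "J \<subseteq> Basis" "card J = 0" "coord_graph J C T" using \<F>[OF T] True by auto
    then have "J = {}" by (metis card_0_eq finite_Basis finite_subset)
    then have "x = y" if "x \<in> T" "y \<in> T" for x y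
      using \<open>coord_graph J C T\<close> that by (simp add: coord_graph_def)
    then have "T \<subseteq> {SOME x. x \<in> T}" by (metis someI singletonI subsetI)
    then show ?thesis by (rule countable_subset) simp
  qed
  then have "countable (\<Union>\<F>)" using countable_UN[OF assms(1), of "\<lambda>T. T"] by simp
  then show ?thesis using True assms(2) countable_subset by (auto simp: rectifiable_def)
next
  case False
  have "\<exists>f. lipschitz_from_Rm m f \<and> T \<subseteq> f ` topspace (Euclidean_space m)" if "T \<in> \<F>" for T
    using \<F>[OF that] coord_graph_Lipschitz_image by blast
  then obtain F where F: "\<And>T. T \<in> \<F> \<Longrightarrow> lipschitz_from_Rm m (F T)"
    "\<And>T. T \<in> \<F> \<Longrightarrow> T \<subseteq> F T ` topspace (Euclidean_space m)" by metis
  have const: "lipschitz_from_Rm m (\<lambda>_. 0 :: 'a)"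
    unfolding lipschitz_from_Rm_def by (intro exI[of _ 0]) simp
  \<comment> \<open>The constant map ensures that there is something to enumerate when \<open>\<F>\<close> is empty.\<close>
  define G where "G = insert (\<lambda>_. 0) (F ` \<F>)"
  have "countable G" "G \<noteq> {}" using assms(1) by (auto simp: G_def)
  then have rng: "range (from_nat_into G) = G" by simp
  have "lipschitz_from_Rm m g" if "g \<in> G" for g
    using that F const by (auto simp: G_def)
  then have "lipschitz_from_Rm m (from_nat_into G i)" for i
    using rng by (metis rangeI)
  moreover have "S \<subseteq> (\<Union>i. from_nat_into G i ` topspace (Euclidean_space m))"
  proof
    fix x assume "x \<in> S"
    then obtain T where "T \<in> \<F>" "x \<in> T" using assms(2) by blast
    then have x: "x \<in> F T ` topspace (Euclidean_space m)" and "F T \<in> range (from_nat_into G)"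
      using F rng by (auto simp: G_def)
    then obtain i where "F T = from_nat_into G i" by blast
    with x show "x \<in> (\<Union>i. from_nat_into G i ` topspace (Euclidean_space m))"
      by (intro UN_I[of i]) simp_all
  qed
  then have "hausdorff_measure (real m)
      (S - (\<Union>i. from_nat_into G i ` topspace (Euclidean_space m))) = 0"
    by (simp add: Diff_eq_empty_iff[THEN iffD2] hausdorff_null_empty)
  ultimately show ?thesis using False unfolding rectifiable_def by auto
qed

theorem theorem2p2:
  fixes E :: "(real ^ 'n) set" and k :: nat
  assumes "closed E" and "1 \<le> k" and "k \<le> CARD('n) + 1"
  shows "rectifiable (CARD('n) + 1 - k) (medial_axis k E) \<and>
         hausdorff_dimension (medial_axis k E) \<le> of_nat (CARD('n) + 1 - k)"
proof -
  obtain \<F> where "countable \<F>" and cov: "medial_axis k E \<subseteq> \<Union>\<F>"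
    and \<F>: "\<And>S. S \<in> \<F> \<Longrightarrow>
      \<exists>J C. J \<subseteq> Basis \<and> card J = CARD('n) + 1 - k \<and> C \<ge> 0 \<and> coord_graph J C S"
    using medial_axis_countable_cover[OF \<open>1 \<le> k\<close>, of E] by auto
  have "rectifiable (CARD('n) + 1 - k) (medial_axis k E)"
    using \<open>countable \<F>\<close> cov \<F> by (rule rectifiable_coord_graphs)
  moreover have "hausdorff_dimension (medial_axis k E) \<le> of_nat (CARD('n) + 1 - k)"
  proof (rule hausdorff_dimension_leI)
    fix s assume s: "real (CARD('n) + 1 - k) < s"
    have "hausdorff_measure s S = 0" if "S \<in> \<F>" for S
      using \<F>[OF that] coord_graph_null s by metis
    then have "hausdorff_measure s (\<Union>\<F>) = 0"
      by (rule hausdorff_null_Union[OF \<open>countable \<F>\<close>])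
    then show "hausdorff_measure s (medial_axis k E) = 0"
      using cov by (rule hausdorff_null_subset)
  qed
  ultimately show ?thesis ..
qed

end
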